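(* Let $U_1,\ldots,U_n$ be closed linear subspaces of a real Hilbert space $\mathcal H$, $A_i=N_{U_i}$ for $i=1,\ldots,n$, and $U=U_1\cap\cdots\cap U_n$. Let $G=(\mathcal N,\mathcal E)$ be an algorithmic graph of order $n\ge2$, $G'=(\mathcal N,\mathcal E')$ a connected spanning subgraph of $G$, and $Z\in\mathbb R^{n\times(n-1)}$ with $\operatorname{Lap}(G')=ZZ^*$. Let $\mathcal T=(\mathcal M+\mathcal A)^{-1}\mathcal M$ and $\widetilde{\mathcal T}=\mathcal C^*(\mathcal M+\mathcal A)^{-1}\mathcal C$, $\boldsymbol\alpha=Z^\dagger\boldsymbol\delta\in\mathbb R^{n-1}$ and $E=Z_\otimes^\dagger(\mathcal U^\perp\cap\Delta_n^\perp)\subseteq\mathcal H^{n-1}$, as defined in the context. Then $$\operatorname{Fix}\mathcal T=(\mathbf 1_n,\boldsymbol\alpha)_\otimes U\oplus(\{\mathbf 0_n\}\times E),\qquad \operatorname{Fix}\widetilde{\mathcal T}=\boldsymbol\alpha_\otimes U\oplus E,$$ where $\oplus$ denotes the Minkowski sum with orthogonal summands (i.e. the two summands are moreover mutually orthogonal).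
   Context: $\mathcal H^m$ carries the inner product $\langle\boldsymbol x,\boldsymbol y\rangle=\sum_i\langle x_i,y_i\rangle$. $N_{U_i}(x)=U_i^\perp$ if $x\in U_i$ and $\emptyset$ otherwise (normal cone). $\operatorname{Fix}T=\{x\mid T(x)=x\}$. Graphs: an algorithmic graph of order $n\ge2$ is a directed graph $G=(\mathcal N,\mathcal E)$ with $\mathcal N=\{1,\ldots,n\}$, $\mathcal E\subseteq\mathcal N\times\mathcal N$, $(i,j)\in\mathcal E\Rightarrow i<j$, and $G$ connected (ignoring edge directions). $G'$ is a spanning subgraph of $G$ if $\mathcal E'\subseteq\mathcal E$. $d_i^{\rm in}=|\{j:(j,i)\in\mathcal E\}|$, $d_i^{\rm out}=|\{j:(i,j)\in\mathcal E\}|$, $d_i=d_i^{\rm in}+d_i^{\rm out}$ are the degrees in $G$. The Laplacian of a graph is the $n\times n$ matrix with the degrees of that graph on the diagonal, $-1$ in entry $(i,j)$ if $i,j$ are adjacent (i.e. $(i,j)$ or $(j,i)$ is an edge), and $0$ otherwise. The degree balance of $G$ is $\boldsymbol\delta\in\mathbb R^n$, $\delta_i=d_i^{\rm out}-d_i^{\rm in}$. Notation: for $K\in\mathbb R^{m\times p}$, $K_\otimes:\mathcal H^p\to\mathcal H^m$, $(K_\otimes\boldsymbol x)_i=\sum_jK_{i,j}x_j$; for $\boldsymbol\beta\in\mathbb R^m$, $\boldsymbol\beta_\otimes x=(\beta_1x,\ldots,\beta_mx)$ and $\boldsymbol\beta_\otimes U=\{\boldsymbol\beta_\otimes u\mid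 u\in U\}$. $\mathbf 1_n\in\mathbb R^n$ is the all-ones vector, $(\mathbf 1_n,\boldsymbol\alpha)\in\mathbb R^{2n-1}$ is the concatenation, and $\mathbf 0_n$ is the zero of $\mathcal H^n$. $Z^\dagger$ is the Moore--Penrose inverse and $Z_\otimes^\dagger=(Z^\dagger)_\otimes$. $\Delta_n=\{(x,\ldots,x)\in\mathcal H^n\mid x\in\mathcal H\}$, $\mathcal U=U_1\times\cdots\times U_n\subseteq\mathcal H^n$. Operators: $\mathcal A_D(\boldsymbol x)=A_1(x_1)\times\cdots\times A_n(x_n)$ for $\boldsymbol x\in\mathcal H^n$. $P(G)\in\mathbb R^{n\times n}$ has entries $P(G)_{i,i}=d_i$, $P(G)_{i,j}=-2$ if $(j,i)\in\mathcal E$, and $0$ otherwise. On $\mathcal H^{2n-1}=\mathcal H^n\times\mathcal H^{n-1}$, $$\mathcal M=\begin{bmatrix}\operatorname{Lap}(G') & Z \\ Z^* & I_{n-1}\end{bmatrix}_\otimes,\quad \mathcal C=\begin{bmatrix} Z \\ I_{n-1}\end{bmatrix}_\otimes:\mathcal H^{n-1}\to\mathcal H^{2n-1},\quad \mathcal A=\begin{bmatrix}\mathcal A_D+P(G)_\otimes-\operatorname{Lap}(G')_\otimes & -Z_\otimes \\ Z^*_\otimes & 0\end{bmatrix}.$$ $(\mathcal M+\mathcal A)^{-1}$ is the inverse as a set-valued operator (it is single-valued with full domain). *)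

theory Defs
  imports "HOL-Analysis.Analysis" "HOL-Library.Set_Algebras"
begin

text \<open>
  The node set \<open>{1,\<dots>,n}\<close> is a finite linearly ordered type \<open>'n\<close> with \<open>CARD('n) = n\<close>, and the
  index set of the \<open>n - 1\<close> columns of \<open>Z\<close> is a finite type \<open>'m\<close> with \<open>CARD('n) = CARD('m) + 1\<close>.
  Then \<open>H\<^sup>n\<close> is \<open>'a ^ 'n\<close> and \<open>H\<^sup>2\<^sup>n\<^sup>-\<^sup>1 = H\<^sup>n \<times> H\<^sup>n\<^sup>-\<^sup>1\<close> is the product type
  \<open>('a ^ 'n) \<times> ('a ^ 'm)\<close>; the library inner products on these types are the sums of the
  componentwise inner products. A graph is given by its set of directed edges.
\<close>

subsection \<open>Graphs\<close>

definition graph_connected :: "('n \<times> 'n) set \<Rightarrow> bool" where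
  "graph_connected E \<longleftrightarrow> (\<forall>i j. (i, j) \<in> (E \<union> E\<inverse>)\<^sup>*)"

definition algorithmic_graph :: "('n::{finite,linorder} \<times> 'n) set \<Rightarrow> bool" where
  "algorithmic_graph E \<longleftrightarrow>
     2 \<le> CARD('n) \<and> (\<forall>i j. (i, j) \<in> E \<longrightarrow> i < j) \<and> graph_connected E"

definition deg_in :: "('n::finite \<times> 'n) set \<Rightarrow> 'n \<Rightarrow> nat" where
  "deg_in E i = card {j. (j, i) \<in> E}"

definition deg_out :: "('n::finite \<times> 'n) set \<Rightarrow> 'n \<Rightarrow> nat" where
  "deg_out E i = card {j. (i, j) \<in> E}"

definition deg :: "('n::finite \<times> 'n) set \<Rightarrow> 'n \<Rightarrow> nat" where
  "deg E i = deg_in E i + deg_out E i"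

definition Lap :: "('n::finite \<times> 'n) set \<Rightarrow> real ^ 'n ^ 'n" where
  "Lap E = (\<chi> i j. if i = j then real (deg E i)
                    else if (i, j) \<in> E \<or> (j, i) \<in> E then - 1 else 0)"

definition degree_balance :: "('n::finite \<times> 'n) set \<Rightarrow> real ^ 'n" where
  "degree_balance E = (\<chi> i. real (deg_out E i) - real (deg_in E i))"

definition P_mat :: "('n::finite \<times> 'n) set \<Rightarrow> real ^ 'n ^ 'n" where
  "P_mat E = (\<chi> i j. if i = j then real (deg E i) else if (j, i) \<in> E then - 2 else 0)"

subsection \<open>Real matrices and vectors acting on powers of the Hilbert space\<close>

definition is_moore_penrose :: "real ^ 'p ^ 'k \<Rightarrow> real ^ 'k ^ 'p \<Rightarrow> bool" where
  "is_moore_penrose K X \<longleftrightarrow>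
     K ** X ** K = K \<and> X ** K ** X = X \<and>
     transpose (K ** X) = K ** X \<and> transpose (X ** K) = X ** K"

definition moore_penrose :: "real ^ 'p ^ 'k \<Rightarrow> real ^ 'k ^ 'p" where
  "moore_penrose K = (THE X. is_moore_penrose K X)"

definition mat_tensor :: "real ^ 'p ^ 'k \<Rightarrow> 'a::real_vector ^ 'p \<Rightarrow> 'a ^ 'k" where
  "mat_tensor K x = (\<chi> i. \<Sum>j\<in>UNIV. (K $ i $ j) *\<^sub>R (x $ j))"

definition vec_tensor :: "real ^ 'k \<Rightarrow> 'a::real_vector \<Rightarrow> 'a ^ 'k" where
  "vec_tensor \<beta> x = (\<chi> i. (\<beta> $ i) *\<^sub>R x)"

text \<open>The same operation for a vector written as the concatenation of two blocks.\<close>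

definition pair_tensor ::
    "(real ^ 'k) \<times> (real ^ 'p) \<Rightarrow> 'a::real_vector \<Rightarrow> ('a ^ 'k) \<times> ('a ^ 'p)" where
  "pair_tensor \<beta> x = (vec_tensor (fst \<beta>) x, vec_tensor (snd \<beta>) x)"

definition diagonal :: "('a ^ 'n) set" where
  "diagonal = {x. \<exists>y. x = (\<chi> i. y)}"

definition product_set :: "('n \<Rightarrow> 'a set) \<Rightarrow> ('a ^ 'n) set" where
  "product_set U = {x. \<forall>i. x $ i \<in> U i}"

subsection \<open>Set-valued operators\<close>

definition normal_cone :: "'a::real_inner set \<Rightarrow> 'a \<Rightarrow> 'a set" where
  "normal_cone V x = (if x \<in> V then V\<^sup>\<bottom> else {})"

definition op_inverse :: "('a \<Rightarrow> 'b set) \<Rightarrow> 'b \<Rightarrow> 'a set" where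
  "op_inverse T y = {x. y \<in> T x}"

text \<open>
  For set-valued operators, \<open>T(x) = x\<close> is read as \<open>T x = {x}\<close>: the value is the single point \<open>x\<close>.
\<close>

definition Fix :: "('a \<Rightarrow> 'a set) \<Rightarrow> 'a set" where
  "Fix T = {x. T x = {x}}"

definition A_D :: "('n \<Rightarrow> 'a \<Rightarrow> 'a set) \<Rightarrow> 'a ^ 'n \<Rightarrow> ('a ^ 'n) set" where
  "A_D A x = product_set (\<lambda>i. A i (x $ i))"

definition M_op :: "('n::finite \<times> 'n) set \<Rightarrow> real ^ 'm ^ 'n \<Rightarrow>
    ('a::real_vector ^ 'n) \<times> ('a ^ 'm) \<Rightarrow> ('a ^ 'n) \<times> ('a ^ 'm)" where
  "M_op E' Z = (\<lambda>(x, v). (mat_tensor (Lap E') x + mat_tensor Z v,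
                            mat_tensor (transpose Z) x + mat_tensor (mat 1) v))"

definition C_op :: "real ^ 'm ^ 'n \<Rightarrow> 'a::real_vector ^ 'm \<Rightarrow> ('a ^ 'n) \<times> ('a ^ 'm)" where
  "C_op Z v = (mat_tensor Z v, mat_tensor (mat 1) v)"

definition A_op :: "('n \<Rightarrow> 'a \<Rightarrow> 'a set) \<Rightarrow> ('n::finite \<times> 'n) set \<Rightarrow> ('n \<times> 'n) set \<Rightarrow>
    real ^ 'm ^ 'n \<Rightarrow> ('a::real_vector ^ 'n) \<times> ('a ^ 'm) \<Rightarrow> (('a ^ 'n) \<times> ('a ^ 'm)) set" where
  "A_op A E E' Z = (\<lambda>(x, v).
     {(a + mat_tensor (P_mat E) x - mat_tensor (Lap E') x - mat_tensor Z v,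
       mat_tensor (transpose Z) x) | a. a \<in> A_D A x})"

definition M_plus_A :: "('n \<Rightarrow> 'a \<Rightarrow> 'a set) \<Rightarrow> ('n::finite \<times> 'n) set \<Rightarrow> ('n \<times> 'n) set \<Rightarrow>
    real ^ 'm ^ 'n \<Rightarrow> ('a::real_vector ^ 'n) \<times> ('a ^ 'm) \<Rightarrow> (('a ^ 'n) \<times> ('a ^ 'm)) set" where
  "M_plus_A A E E' Z z = (\<lambda>b. M_op E' Z z + b) ` A_op A E E' Z z"

definition T_op :: "('n \<Rightarrow> 'a \<Rightarrow> 'a set) \<Rightarrow> ('n::finite \<times> 'n) set \<Rightarrow> ('n \<times> 'n) set \<Rightarrow>
    real ^ 'm ^ 'n \<Rightarrow> ('a::real_vector ^ 'n) \<times> ('a ^ 'm) \<Rightarrow> (('a ^ 'n) \<times> ('a ^ 'm)) set" where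
  "T_op A E E' Z z = op_inverse (M_plus_A A E E' Z) (M_op E' Z z)"

definition T_reduced :: "('n \<Rightarrow> 'a \<Rightarrow> 'a set) \<Rightarrow> ('n::finite \<times> 'n) set \<Rightarrow> ('n \<times> 'n) set \<Rightarrow>
    real ^ 'm ^ 'n \<Rightarrow> 'a::real_inner ^ 'm \<Rightarrow> ('a ^ 'm) set" where
  "T_reduced A E E' Z v = adjoint (C_op Z) ` op_inverse (M_plus_A A E E' Z) (C_op Z v)"

subsection \<open>Data of the fixed-point sets\<close>

definition alpha :: "('n::finite \<times> 'n) set \<Rightarrow> real ^ 'm ^ 'n \<Rightarrow> real ^ 'm" where
  "alpha E Z = moore_penrose Z *v degree_balance E"

definition E_set :: "real ^ 'm ^ 'n \<Rightarrow> ('n \<Rightarrow> 'a::real_inner set) \<Rightarrow> ('a ^ 'm) set" where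
  "E_set Z U = mat_tensor (moore_penrose Z) ` ((product_set U)\<^sup>\<bottom> \<inter> diagonal\<^sup>\<bottom>)"

definition is_orthogonal_sum ::
    "'b::real_inner set \<Rightarrow> 'b set \<Rightarrow> 'b set \<Rightarrow> bool" where
  "is_orthogonal_sum X V W \<longleftrightarrow> X = V + W \<and> (\<forall>v\<in>V. \<forall>w\<in>W. orthogonal v w)"

end

theory Submission
  imports Defs
begin

text \<open>
  Adding \<open>\<M>\<close> and \<open>\<A>\<close> cancels the Laplacian and \<open>Z\<close> in the first block: \<open>(x, v)\<close> lies in
  \<open>(\<M> + \<A>)\<inverse> (p, q)\<close> iff \<open>p - P(G) x \<in> \<A>\<^sub>D x\<close> and \<open>q = 2 Z\<^sup>* x + v\<close> (\<open>mem_resolvent_iff\<close>). Since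
  \<open>P(G)\<close> is lower triangular with positive diagonal and every \<open>A\<^sub>i\<close> is monotone, such an
  \<open>(x, v)\<close> is unique (\<open>resolvent_unique\<close>), so that fixed points are characterised by mere
  membership in the image of the operator.

  Put \<open>(p, q) = \<M> (x, v)\<close>. The second block says \<open>Z\<^sup>* x = 0\<close>, that is \<open>Lap(G') x = 0\<close>, and as
  \<open>G'\<close> is connected this forces \<open>x = (y, \<dots>, y)\<close> (\<open>Lap_kernel\<close>). The row sums of \<open>P(G)\<close> are the
  entries of the degree balance \<open>\<delta>\<close>, so the first block becomes \<open>y \<in> U\<close> and
  \<open>Z v - \<delta> y \<in> \<U>\<^sup>\<bottom>\<close> (\<open>Fix_T_op_eq\<close>).

  The kernel of \<open>Z\<^sup>*\<close> on \<open>\<real>\<^sup>n\<close> is a line, so \<open>Z\<close>, which has \<open>n - 1\<close> columns, is injective and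
  \<open>Z\<^sup>\<dagger>\<close> is a left inverse of it, while \<open>Z Z\<^sup>\<dagger>\<close> is the projection onto \<open>\<Delta>\<^sup>\<bottom>\<close>, the range of \<open>Z\<close>.
  Because the entries of \<open>\<delta>\<close> sum to zero, \<open>\<delta> y = Z (\<alpha> y)\<close>, and \<open>w = v - \<alpha> y\<close> ranges over all vectors
  with \<open>Z w \<in> \<U>\<^sup>\<bottom>\<close>; these are exactly the elements of \<open>E\<close>. The summands are orthogonal because
  moving \<open>Z\<^sup>\<dagger>\<close> to the other side of \<open>\<langle>\<alpha> y, Z\<^sup>\<dagger> u\<rangle>\<close> leaves a vector all of whose components are
  multiples of \<open>y \<in> U\<close>, hence an element of \<open>\<U>\<close>, paired with \<open>u \<in> \<U>\<^sup>\<bottom>\<close>.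

  Finally, \<open>v\<close> is fixed by the reduced operator iff it is the second component of a fixed point of the
  full one (\<open>Fix_T_reduced_eq\<close>).
\<close>

section \<open>Real matrices acting on powers of a vector space\<close>

lemma linear_mat_tensor: "linear (mat_tensor K)"
  by (rule linearI)
     (simp_all add: mat_tensor_def vec_eq_iff scaleR_add_right sum.distrib scaleR_sum_right mult.commute)

lemmas mat_tensor_diff = linear_diff[OF linear_mat_tensor]
  and mat_tensor_0 = linear_0[OF linear_mat_tensor]

lemma mat_tensor_mult: "mat_tensor (K ** L) x = mat_tensor K (mat_tensor L x)"
proof -
  have "(\<Sum>j\<in>UNIV. (\<Sum>k\<in>UNIV. K $ i $ k * L $ k $ j) *\<^sub>R x $ j) =
        (\<Sum>k\<in>UNIV. K $ i $ k *\<^sub>R (\<Sum>j\<in>UNIV. L $ k $ j *\<^sub>R x $ j))" for i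
    unfolding scaleR_sum_left scaleR_sum_right scaleR_scaleR by (rule sum.swap)
  then show ?thesis
    by (simp add: mat_tensor_def matrix_matrix_mult_def vec_eq_iff)
qed

lemma mat_tensor_mat_1: "mat_tensor (mat 1) x = x"
  by (simp add: mat_tensor_def mat_def vec_eq_iff if_distrib[of "\<lambda>c. c *\<^sub>R _"] cong: if_cong)

lemma mat_tensor_vec_tensor: "mat_tensor K (vec_tensor \<beta> y) = vec_tensor (K *v \<beta>) y"
  by (simp add: mat_tensor_def vec_tensor_def matrix_vector_mult_def vec_eq_iff scaleR_sum_left)

lemma mat_tensor_real: "mat_tensor K (x :: real ^ 'p) = K *v x"
  by (simp add: mat_tensor_def matrix_vector_mult_def)

lemma inner_mat_tensor:
  fixes x :: "'a::real_inner ^ 'p"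
  shows "inner (mat_tensor K x) y = inner x (mat_tensor (transpose K) y)"
proof -
  have "(\<Sum>i\<in>UNIV. \<Sum>j\<in>UNIV. K $ i $ j * inner (x $ j) (y $ i)) =
        (\<Sum>j\<in>UNIV. \<Sum>i\<in>UNIV. K $ i $ j * inner (x $ j) (y $ i))"
    by (rule sum.swap)
  then show ?thesis
    by (simp add: mat_tensor_def transpose_def inner_vec_def inner_sum_left inner_sum_right)
qed

text \<open>
The usual \<open>\<parallel>Z\<^sup>* x\<parallel>\<^sup>2 = \<langle>x, Z Z\<^sup>* x\<rangle>\<close>; it transfers the kernel of the Laplacian to its factor.
\<close>

lemma mat_tensor_transpose_eq_0_iff:
  fixes x :: "'a::real_inner ^ 'n"
  shows "mat_tensor (transpose Z) x = 0 \<longleftrightarrow> mat_tensor (Z ** transpose Z) x = 0"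
proof
  assume "mat_tensor (Z ** transpose Z) x = 0"
  then have "inner (mat_tensor (transpose Z) x) (mat_tensor (transpose Z) x) = 0"
    by (simp add: inner_mat_tensor mat_tensor_mult[symmetric])
  then show "mat_tensor (transpose Z) x = 0"
    by simp
qed (simp add: mat_tensor_mult mat_tensor_0)

lemma diagonal_iff: "x \<in> diagonal \<longleftrightarrow> (\<exists>y. x = vec_tensor 1 y)"
  by (simp add: diagonal_def vec_tensor_def)

lemma diagonal_comp_iff:
  fixes x :: "'a::real_inner ^ 'n"
  shows "x \<in> diagonal\<^sup>\<bottom> \<longleftrightarrow> (\<Sum>i\<in>UNIV. x $ i) = 0"
proof -
  have "x \<in> diagonal\<^sup>\<bottom> \<longleftrightarrow> (\<forall>y. inner y (\<Sum>i\<in>UNIV. x $ i) = 0)"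
    by (auto simp: orthogonal_comp_def diagonal_def orthogonal_def inner_vec_def inner_sum_right)
  then show ?thesis
    by (metis inner_eq_zero_iff inner_zero_right)
qed

text \<open>
Testing against vectors with a single nonzero component, which belong to the product as \<open>0 \<in> U i\<close>,
  separates the components.
\<close>

lemma product_set_comp_iff:
  fixes U :: "'n::finite \<Rightarrow> 'a::real_inner set"
  assumes "\<And>i. 0 \<in> U i"
  shows "u \<in> (product_set U)\<^sup>\<bottom> \<longleftrightarrow> (\<forall>i. u $ i \<in> (U i)\<^sup>\<bottom>)"
proof
  assume u: "u \<in> (product_set U)\<^sup>\<bottom>"
  have "inner y (u $ i) = 0" if "y \<in> U i" for i y
  proof -
    have "axis i y \<in> product_set U"
      using that assms by (simp add: product_set_def axis_def)
    then have "inner (axis i y) u = 0"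
      using u by (simp add: orthogonal_comp_def orthogonal_def)
    then show ?thesis
      by (simp add: inner_axis')
  qed
  then show "\<forall>i. u $ i \<in> (U i)\<^sup>\<bottom>"
    by (simp add: orthogonal_comp_def orthogonal_def)
qed (simp add: orthogonal_comp_def orthogonal_def product_set_def inner_vec_def)

section \<open>The Laplacian of a connected oriented graph\<close>

lemma deg_out_eq_sum: "real (deg_out E i) = (\<Sum>j\<in>UNIV. of_bool ((i, j) \<in> E))"
  by (simp add: deg_out_def)

lemma deg_in_eq_sum: "real (deg_in E i) = (\<Sum>j\<in>UNIV. of_bool ((j, i) \<in> E))"
  by (simp add: deg_in_def)

text \<open>
  For a graph without antiparallel edges or loops the Laplacian acts as a weighted difference
  operator, the weight counting the edges between two nodes in both directions.
\<close>

lemma Lap_tensor_nth: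
  assumes asym: "\<And>i j. (i, j) \<in> E \<Longrightarrow> (j, i) \<notin> E"
  shows "mat_tensor (Lap E) x $ i =
    (\<Sum>j\<in>UNIV. (of_bool ((i, j) \<in> E) + of_bool ((j, i) \<in> E)) *\<^sub>R (x $ i - x $ j))"
proof -
  define c :: "'a \<Rightarrow> real" where "c j = of_bool ((i, j) \<in> E) + of_bool ((j, i) \<in> E)" for j
  have "Lap E $ i $ j *\<^sub>R x $ j = (if i = j then sum c UNIV *\<^sub>R x $ j else 0) - c j *\<^sub>R x $ j" for j
    using asym[of i j] asym[of i i]
    by (auto simp: Lap_def c_def deg_def deg_out_eq_sum deg_in_eq_sum sum.distrib)
  then have "mat_tensor (Lap E) x $ i = sum c UNIV *\<^sub>R x $ i - (\<Sum>j\<in>UNIV. c j *\<^sub>R x $ j)"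
    by (simp add: mat_tensor_def sum_subtractf)
  also have "\<dots> = (\<Sum>j\<in>UNIV. c j *\<^sub>R (x $ i - x $ j))"
    by (simp add: scaleR_diff_right sum_subtractf scaleR_sum_left)
  finally show ?thesis
    by (simp add: c_def)
qed

text \<open>
  Exchanging the names of the two endpoints in the contribution of incoming edges combines it with
  that of outgoing edges to a complete square.
\<close>

lemma Lap_energy:
  fixes x :: "'a::real_inner ^ 'n::finite"
  assumes asym: "\<And>i j. (i, j) \<in> E \<Longrightarrow> (j, i) \<notin> E"
  shows "inner x (mat_tensor (Lap E) x) =
    (\<Sum>i\<in>UNIV. \<Sum>j\<in>UNIV. of_bool ((i, j) \<in> E) * (norm (x $ i - x $ j))\<^sup>2)"
proof -
  define e :: "'n \<Rightarrow> 'n \<Rightarrow> real" where "e i j = of_bool ((i, j) \<in> E)" for i j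
  have "inner x (mat_tensor (Lap E) x) =
      (\<Sum>i\<in>UNIV. \<Sum>j\<in>UNIV. e i j * inner (x $ i) (x $ i - x $ j)) +
      (\<Sum>i\<in>UNIV. \<Sum>j\<in>UNIV. e j i * inner (x $ i) (x $ i - x $ j))"
    by (simp add: inner_vec_def Lap_tensor_nth[OF asym] inner_sum_right e_def distrib_right sum.distrib)
  also have "(\<Sum>i\<in>UNIV. \<Sum>j\<in>UNIV. e j i * inner (x $ i) (x $ i - x $ j)) =
      (\<Sum>i\<in>UNIV. \<Sum>j\<in>UNIV. e i j * inner (x $ j) (x $ j - x $ i))"
    by (rule sum.swap)
  finally have "inner x (mat_tensor (Lap E) x) =
      (\<Sum>i\<in>UNIV. \<Sum>j\<in>UNIV. e i j * (inner (x $ i) (x $ i - x $ j) + inner (x $ j) (x $ j - x $ i)))"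
    by (simp only: sum.distrib distrib_left)
  moreover have "inner a (a - b) + inner b (b - a) = (norm (a - b))\<^sup>2" for a b :: 'a
    by (simp add: power2_norm_eq_inner inner_diff_left inner_diff_right)
  ultimately show ?thesis
    by (simp add: e_def)
qed

text \<open>
  Vanishing energy means that \<open>x\<close> agrees across each edge, hence along each path.
\<close>

lemma Lap_kernel:
  fixes x :: "'a::real_inner ^ 'n::finite"
  assumes asym: "\<And>i j. (i, j) \<in> E \<Longrightarrow> (j, i) \<notin> E" and conn: "graph_connected E"
  shows "mat_tensor (Lap E) x = 0 \<longleftrightarrow> x \<in> diagonal"
proof
  assume "mat_tensor (Lap E) x = 0"
  then have "(\<Sum>i\<in>UNIV. \<Sum>j\<in>UNIV. of_bool ((i, j) \<in> E) * (norm (x $ i - x $ j))\<^sup>2) = 0"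
    using Lap_energy[OF asym, where x = x] by simp
  then have edge: "x $ i = x $ j" if "(i, j) \<in> E" for i j
    using that by (simp add: sum_nonneg_eq_0_iff sum_nonneg)
  have "x $ i = x $ j" if "(i, j) \<in> (E \<union> E\<inverse>)\<^sup>*" for i j
    using that by induction (auto dest: edge)
  then have "x = (\<chi> i. x $ undefined)"
    using conn by (simp add: vec_eq_iff graph_connected_def)
  then show "x \<in> diagonal"
    unfolding diagonal_def by blast
qed (auto simp: vec_eq_iff Lap_tensor_nth[OF asym] diagonal_def)

lemma algorithmic_graph_asym:
  assumes "algorithmic_graph E" "(i, j) \<in> E"
  shows "(j, i) \<notin> E"
  using assms by (metis algorithmic_graph_def order_less_asym)

lemma deg_pos:
  assumes "algorithmic_graph E"
  shows "deg E i > 0"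
proof -
  have "\<exists>j. j \<noteq> i"
  proof (rule ccontr)
    assume "\<nexists>j. j \<noteq> i"
    then have "(UNIV :: 'a set) = {i}"
      by auto
    then have "CARD('a) = 1"
      by (metis card_1_singleton_iff One_nat_def)
    then show False
      using assms by (simp add: algorithmic_graph_def)
  qed
  then obtain j where "j \<noteq> i"
    by blast
  moreover have "(i, j) \<in> (E \<union> E\<inverse>)\<^sup>*"
    using assms by (simp add: algorithmic_graph_def graph_connected_def)
  ultimately obtain k where "(i, k) \<in> E \<or> (k, i) \<in> E"
    by (metis UnE converseD converse_rtranclE)
  then show ?thesis
    by (auto simp: deg_def deg_in_def deg_out_def card_gt_0_iff)
qed

text \<open>
  The \<open>i\<close>-th row sum of \<open>P(G)\<close> is \<open>d\<^sub>i - 2 d\<^sub>i\<^sup>i\<^sup>n = d\<^sub>i\<^sup>o\<^sup>u\<^sup>t - d\<^sub>i\<^sup>i\<^sup>n\<close>.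
\<close>

lemma P_mat_tensor_ones:
  assumes asym: "\<And>i j. (i, j) \<in> E \<Longrightarrow> (j, i) \<notin> E"
  shows "mat_tensor (P_mat E) (vec_tensor 1 y) = vec_tensor (degree_balance E) y"
proof -
  have "P_mat E $ i $ j = (if i = j then real (deg E i) else 0) - 2 * of_bool ((j, i) \<in> E)" for i j
    using asym[of i i] by (auto simp: P_mat_def)
  then have "P_mat E *v 1 = degree_balance E"
    by (simp add: vec_eq_iff matrix_vector_mult_def degree_balance_def sum_subtractf
        sum_distrib_left[symmetric] deg_in_eq_sum[symmetric] deg_def del: sum_of_bool_eq)
  then show ?thesis
    by (simp add: mat_tensor_vec_tensor)
qed

lemma sum_degree_balance: "(\<Sum>i\<in>UNIV. degree_balance E $ i) = 0"
proof -
  have "(\<Sum>i\<in>UNIV. real (deg_out E i)) = (\<Sum>i\<in>UNIV. real (deg_in E i))"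
    unfolding deg_out_eq_sum deg_in_eq_sum by (rule sum.swap)
  then show ?thesis
    by (simp add: degree_balance_def sum_subtractf)
qed

section \<open>Moore--Penrose inverse of a factor of the Laplacian\<close>

text \<open>
  Both \<open>K X\<close> and \<open>K Y\<close> are symmetric projections onto the range of \<open>K\<close>, hence equal, and likewise
  \<open>X K\<close> and \<open>Y K\<close>; thus \<open>X = X K X = X K Y = Y K Y = Y\<close>.
\<close>

lemma is_moore_penrose_unique:
  assumes X: "is_moore_penrose K X" and Y: "is_moore_penrose K Y"
  shows "X = Y"
proof -
  have sX: "transpose (K ** X) = K ** X" "transpose (X ** K) = X ** K"
    and sY: "transpose (K ** Y) = K ** Y" "transpose (Y ** K) = Y ** K"
    and K: "K ** X ** K = K" "K ** Y ** K = K"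
    and XY: "X ** K ** X = X" "Y ** K ** Y = Y"
    using X Y by (simp_all add: is_moore_penrose_def)
  have "K ** X = (K ** Y) ** (K ** X)"
    by (simp only: matrix_mul_assoc K)
  also have "\<dots> = transpose ((K ** X) ** (K ** Y))"
    by (simp only: matrix_transpose_mul[of "K ** X" "K ** Y"] sX sY)
  also have "\<dots> = K ** Y"
    by (simp only: matrix_mul_assoc K sY)
  finally have KX: "K ** X = K ** Y" .
  have "X ** K = (X ** K) ** (Y ** K)"
    by (simp only: matrix_mul_assoc[symmetric] K[folded matrix_mul_assoc])
  also have "\<dots> = transpose ((Y ** K) ** (X ** K))"
    by (simp only: matrix_transpose_mul[of "Y ** K" "X ** K"] sX sY)
  also have "\<dots> = Y ** K"
    by (simp only: matrix_mul_assoc[symmetric] K[folded matrix_mul_assoc] sY)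
  finally have XK: "X ** K = Y ** K" .
  have "X = X ** (K ** X)"
    using XY(1) by (simp add: matrix_mul_assoc)
  also have "\<dots> = X ** K ** Y"
    by (simp only: KX matrix_mul_assoc)
  also have "\<dots> = Y"
    by (simp only: XK XY(2))
  finally show ?thesis .
qed

lemma moore_penrose_eqI: "is_moore_penrose K X \<Longrightarrow> moore_penrose K = X"
  unfolding moore_penrose_def using is_moore_penrose_unique by blast

text \<open>
  An injective \<open>K\<close> has invertible Gram matrix \<open>K\<^sup>* K\<close>, and \<open>(K\<^sup>* K)\<inverse> K\<^sup>*\<close> satisfies the four
  Penrose equations.
\<close>

lemma moore_penrose_injective:
  fixes K :: "real ^ 'p ^ 'k"
  assumes "inj ((*v) K)"
  shows "is_moore_penrose K (moore_penrose K)" and "moore_penrose K ** K = mat 1"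
proof -
  have "v = 0" if "(transpose K ** K) *v v = 0" for v
  proof -
    have "inner (K *v v) (K *v v) = inner v ((transpose K ** K) *v v)"
      using inner_mat_tensor[of K v "K *v v"] by (simp add: mat_tensor_real matrix_vector_mul_assoc)
    then have "K *v v = K *v 0"
      using that by simp
    then show "v = 0"
      by (rule injD[OF assms])
  qed
  then obtain Q where Q: "Q ** (transpose K ** K) = mat 1"
    using matrix_left_invertible_ker[of "transpose K ** K"] by blast
  define X where "X = Q ** transpose K"
  have XK: "X ** K = mat 1"
    using Q by (simp add: X_def matrix_mul_assoc)
  have "transpose K ** K ** transpose Q = mat 1"
    using arg_cong[OF Q, of transpose]
    by (simp add: matrix_transpose_mul transpose_mat)
  then have "Q = Q ** (transpose K ** K ** transpose Q)"
    by simp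
  also have "\<dots> = Q ** (transpose K ** K) ** transpose Q"
    by (simp only: matrix_mul_assoc)
  also have "\<dots> = transpose Q"
    by (simp add: Q)
  finally have "transpose Q = Q" ..
  then have "transpose (K ** X) = K ** X"
    by (simp add: X_def matrix_transpose_mul matrix_mul_assoc)
  moreover have "K ** X ** K = K" "X ** K ** X = X"
    using XK by (simp_all add: matrix_mul_assoc[symmetric, of K] )
  ultimately have X: "is_moore_penrose K X"
    using XK by (simp add: is_moore_penrose_def transpose_mat)
  then show "is_moore_penrose K (moore_penrose K)" and "moore_penrose K ** K = mat 1"
    using XK by (simp_all add: moore_penrose_eqI[OF X])
qed

text \<open>
  On the hyperplane orthogonal to the all-ones vector, which has dimension \<open>n - 1\<close>, \<open>Z\<^sup>*\<close> is
  injective. Hence \<open>Z\<^sup>*\<close> maps it onto \<open>\<real>\<^sup>n\<^sup>-\<^sup>1\<close>, and the transpose of a surjective matrix is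
  injective.
\<close>

lemma injective_if_transpose_kernel_diagonal:
  fixes Z :: "real ^ 'm ^ 'n"
  assumes card: "CARD('n) = CARD('m) + 1"
    and ker: "\<And>x :: real ^ 'n. mat_tensor (transpose Z) x = 0 \<Longrightarrow> x \<in> diagonal"
  shows "inj ((*v) Z)"
proof -
  define S where "S = {x :: real ^ 'n. inner 1 x = 0}"
  have S: "subspace S"
    unfolding S_def by (rule subspace_hyperplane)
  have "x = 0" if "x \<in> S" "transpose Z *v x = 0" for x
  proof -
    have "x \<in> diagonal"
      using ker[of x] that(2) by (simp only: mat_tensor_real)
    then obtain y where y: "x = vec_tensor 1 y"
      using diagonal_iff by blast
    then show ?thesis
      using that by (simp add: S_def inner_vec_def vec_tensor_def vec_eq_iff)
  qed
  then have "inj_on ((*v) (transpose Z)) S"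
    using S by (simp add: linear_injective_on_subspace_0)
  then have "dim ((*v) (transpose Z) ` S) = dim S"
    using S by (intro dim_image_eq) (simp_all add: span_eq_iff[THEN iffD2])
  also have "\<dots> = CARD('m)"
    using card dim_hyperplane[of "1 :: real ^ 'n"] by (simp add: S_def)
  finally have "span ((*v) (transpose Z) ` S) = UNIV"
    using dim_eq_full[of "(*v) (transpose Z) ` S"] by simp
  moreover have "subspace ((*v) (transpose Z) ` S)"
    using matrix_vector_mul_linear S by (rule linear_subspace_image)
  ultimately have onto: "(*v) (transpose Z) ` S = UNIV"
    by (metis span_eq_iff)
  have "v = 0" if "Z *v v = 0" for v
  proof -
    obtain x where "v = transpose Z *v x"
      using onto by blast
    then have "inner v v = 0"
      using that inner_mat_tensor[of Z v x] by (simp add: mat_tensor_real)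
    then show ?thesis
      by simp
  qed
  then show ?thesis
    by (simp add: vec.inj_iff_eq_0)
qed

text \<open>
  The residual \<open>d = u - Z X u\<close> is annihilated by \<open>Z\<^sup>*\<close>, since \<open>Z\<^sup>* Z X = (Z X Z)\<^sup>* = Z\<^sup>*\<close>. Thus \<open>d\<close> is
  diagonal and therefore orthogonal to both \<open>u\<close> and the range of \<open>Z\<close>, so to itself. Arguing in \<open>\<H>\<^sup>n\<close>
  directly avoids computing the matrix \<open>Z X\<close>.
\<close>

lemma factor_moore_penrose_on_diagonal_comp:
  fixes Z :: "real ^ 'm ^ 'n" and u :: "'a::real_inner ^ 'n"
  assumes mp: "is_moore_penrose Z X"
    and ker: "\<And>x :: 'a ^ 'n. mat_tensor (transpose Z) x = 0 \<longleftrightarrow> x \<in> diagonal"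
    and u: "u \<in> diagonal\<^sup>\<bottom>"
  shows "mat_tensor Z (mat_tensor X u) = u"
proof -
  have "transpose Z ** (Z ** X) = transpose (Z ** X ** Z)"
    using mp by (metis is_moore_penrose_def matrix_transpose_mul)
  also have "\<dots> = transpose Z"
    using mp by (simp add: is_moore_penrose_def)
  finally have "mat_tensor (transpose Z) (u - mat_tensor Z (mat_tensor X u)) = 0"
    by (simp add: mat_tensor_diff mat_tensor_mult[symmetric] matrix_mul_assoc)
  then have d: "u - mat_tensor Z (mat_tensor X u) \<in> diagonal" (is "?d \<in> _")
    using ker by blast
  then have "inner ?d u = 0" and "mat_tensor (transpose Z) ?d = 0"
    using u ker by (auto simp: orthogonal_comp_def orthogonal_def)
  moreover have "inner ?d (mat_tensor Z w) = 0" if "mat_tensor (transpose Z) ?d = 0" for w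
    using that by (simp add: inner_mat_tensor inner_commute[of ?d])
  ultimately have "inner ?d ?d = 0"
    by (simp add: inner_diff_right)
  then show ?thesis
    by simp
qed

section \<open>The resolvent and its fixed points\<close>

lemma mem_resolvent_iff:
  "(x, v) \<in> op_inverse (M_plus_A A E E' Z) (p, q) \<longleftrightarrow>
     p - mat_tensor (P_mat E) x \<in> A_D A x \<and> q = 2 *\<^sub>R mat_tensor (transpose Z) x + v"
proof -
  let ?P = "mat_tensor (P_mat E) x" and ?t = "mat_tensor (transpose Z) x"
  have "M_op E' Z (x, v) + (a + ?P - mat_tensor (Lap E') x - mat_tensor Z v, ?t) =
      (a + ?P, 2 *\<^sub>R ?t + v)" for a
    by (simp add: M_op_def mat_tensor_mat_1 scaleR_2)
  then have "(p, q) \<in> M_plus_A A E E' Z (x, v) \<longleftrightarrow>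
      (\<exists>a\<in>A_D A x. p = a + ?P \<and> q = 2 *\<^sub>R ?t + v)"
    unfolding M_plus_A_def A_op_def by (force simp: image_iff)
  also have "\<dots> \<longleftrightarrow> p - ?P \<in> A_D A x \<and> q = 2 *\<^sub>R ?t + v"
    by (metis add_diff_cancel_right' diff_add_cancel)
  finally show ?thesis
    by (simp add: op_inverse_def)
qed

text \<open>
  The diagonal operator is itself a normal cone operator, that of the product subspace.
\<close>

lemma A_D_normal_cone:
  assumes "\<And>i. 0 \<in> U i"
  shows "A_D (\<lambda>i. normal_cone (U i)) x = normal_cone (product_set U) x"
  using product_set_comp_iff[of U, OF assms]
  by (auto simp: A_D_def normal_cone_def product_set_def split: if_splits)

text \<open>
  At the first index \<open>i\<close> with \<open>d\<^sub>i \<noteq> 0\<close>, triangularity of \<open>P(G)\<close> leaves only the diagonal term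
  \<open>deg(i) d\<^sub>i\<close>, whose inner product with \<open>d\<^sub>i\<close> is positive. Only the componentwise products are
  useful here: the symmetric part of \<open>P(G)\<close> is the Laplacian of \<open>G\<close>, so \<open>\<langle>d, P(G) d\<rangle>\<close> vanishes on
  every diagonal \<open>d\<close>.
\<close>

lemma P_mat_tensor_definite:
  fixes d :: "'a::real_inner ^ 'n::{finite,linorder}"
  assumes E: "algorithmic_graph E"
    and d: "\<And>i. inner (d $ i) (mat_tensor (P_mat E) d $ i) = 0"
  shows "d = 0"
proof (rule ccontr)
  assume "d \<noteq> 0"
  define i where "i = Min {i. d $ i \<noteq> 0}"
  have "{i. d $ i \<noteq> 0} \<noteq> {}"
    using \<open>d \<noteq> 0\<close> by (auto simp: vec_eq_iff)
  then have i: "d $ i \<noteq> 0" and min: "\<And>j. d $ j \<noteq> 0 \<Longrightarrow> i \<le> j"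
    using Min_in[of "{i. d $ i \<noteq> 0}"] by (auto simp: i_def)
  have "P_mat E $ i $ j *\<^sub>R d $ j = (if i = j then real (deg E i) *\<^sub>R d $ i else 0)" for j
  proof -
    have "(j, i) \<in> E \<Longrightarrow> d $ j = 0"
      using E min[of j] by (metis algorithmic_graph_def leD)
    then show ?thesis
      using i by (auto simp: P_mat_def)
  qed
  then have "mat_tensor (P_mat E) d $ i = real (deg E i) *\<^sub>R d $ i"
    by (simp add: mat_tensor_def)
  then show False
    using d[of i] i deg_pos[OF E, of i] by simp
qed

text \<open>
  For two solutions the \<open>i\<close>-th component of the difference of the \<open>x\<close>-parts lies in \<open>U\<^sub>i\<close>, while its
  image under \<open>P(G)\<close> has \<open>i\<close>-th component in \<open>U\<^sub>i\<^sup>\<bottom>\<close>.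
\<close>

lemma resolvent_unique:
  fixes U :: "'n::{finite,linorder} \<Rightarrow> 'a::real_inner set"
  assumes U: "\<And>i. subspace (U i)" and E: "algorithmic_graph E"
    and z: "z \<in> op_inverse (M_plus_A (\<lambda>i. normal_cone (U i)) E E' Z) y"
    and z': "z' \<in> op_inverse (M_plus_A (\<lambda>i. normal_cone (U i)) E E' Z) y"
  shows "z = z'"
proof -
  obtain x v x' v' p q where eq: "z = (x, v)" "z' = (x', v')" "y = (p, q)"
    by (metis surj_pair)
  let ?P = "mat_tensor (P_mat E)"
  have x: "x $ i \<in> U i" "x' $ i \<in> U i"
      "p $ i - ?P x $ i \<in> (U i)\<^sup>\<bottom>" "p $ i - ?P x' $ i \<in> (U i)\<^sup>\<bottom>" for i
    using z z' unfolding eq mem_resolvent_iff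
    by (auto simp: A_D_def product_set_def normal_cone_def split: if_splits dest!: spec[of _ i])
  have "inner ((x - x') $ i) (?P (x - x') $ i) = 0" for i
  proof -
    have "(x - x') $ i \<in> U i"
      using x U by (simp add: subspace_diff)
    moreover have "?P (x - x') $ i = (p $ i - ?P x' $ i) - (p $ i - ?P x $ i)"
      by (simp add: mat_tensor_diff)
    then have "?P (x - x') $ i \<in> (U i)\<^sup>\<bottom>"
      using x by (simp only: subspace_diff[OF subspace_orthogonal_comp])
    ultimately show ?thesis
      by (simp add: orthogonal_comp_def orthogonal_def)
  qed
  then have "x = x'"
    using P_mat_tensor_definite[OF E] by (metis eq_iff_diff_eq_0)
  then show ?thesis
    using z z' by (auto simp: eq mem_resolvent_iff)
qed

lemma mem_T_op_self_iff:
  "(x, v) \<in> T_op A E E' Z (x, v) \<longleftrightarrow> mat_tensor (transpose Z) x = 0 \<and>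
     mat_tensor (Lap E') x + mat_tensor Z v - mat_tensor (P_mat E) x \<in> A_D A x"
  by (auto simp: T_op_def M_op_def mem_resolvent_iff mat_tensor_mat_1 scaleR_2)

text \<open>
  Fixed points require the value of the operator to be a singleton; by uniqueness, membership is enough.
\<close>

lemma Fix_T_op_iff:
  fixes U :: "'n::{finite,linorder} \<Rightarrow> 'a::real_inner set"
  assumes "\<And>i. subspace (U i)" and "algorithmic_graph E"
  shows "z \<in> Fix (T_op (\<lambda>i. normal_cone (U i)) E E' Z) \<longleftrightarrow>
    z \<in> T_op (\<lambda>i. normal_cone (U i)) E E' Z z"
  using resolvent_unique[where U = U, OF assms] unfolding Fix_def T_op_def by blast

lemma Fix_T_op_eq:
  fixes U :: "'n::{finite,linorder} \<Rightarrow> 'a::real_inner set"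
  assumes U: "\<And>i. subspace (U i)" and E: "algorithmic_graph E"
    and L: "Lap E' = Z ** transpose Z"
    and ker: "\<And>x :: 'a ^ 'n::{finite,linorder}. mat_tensor (transpose Z) x = 0 \<longleftrightarrow> x \<in> diagonal"
  shows "Fix (T_op (\<lambda>i. normal_cone (U i)) E E' Z) =
    {(vec_tensor 1 y, v) | y v. y \<in> (\<Inter>i. U i) \<and>
       mat_tensor Z v - vec_tensor (degree_balance E) y \<in> (product_set U)\<^sup>\<bottom>}"
proof -
  let ?A = "\<lambda>i. normal_cone (U i)"
  have U0: "\<And>i. 0 \<in> U i"
    using U by (simp add: subspace_0)
  have P1: "mat_tensor (P_mat E) (vec_tensor 1 y) = vec_tensor (degree_balance E) (y :: 'a)" for y
    by (rule P_mat_tensor_ones[OF algorithmic_graph_asym[OF E]])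
  have L1: "mat_tensor (Lap E') x = 0" if "mat_tensor (transpose Z) x = 0" for x :: "'a ^ 'n::{finite,linorder}"
    using that by (simp add: L mat_tensor_mult mat_tensor_0)
  have U1: "vec_tensor 1 y \<in> product_set U \<longleftrightarrow> y \<in> (\<Inter>i. U i)" for y
    by (simp add: product_set_def vec_tensor_def)
  have "(x, v) \<in> Fix (T_op ?A E E' Z) \<longleftrightarrow>
      (\<exists>y. x = vec_tensor 1 y \<and> y \<in> (\<Inter>i. U i) \<and>
        mat_tensor Z v - vec_tensor (degree_balance E) y \<in> (product_set U)\<^sup>\<bottom>)" for x v
  proof -
    have "(x, v) \<in> Fix (T_op ?A E E' Z) \<longleftrightarrow> mat_tensor (transpose Z) x = 0 \<and>
        mat_tensor Z v - mat_tensor (P_mat E) x \<in> normal_cone (product_set U) x"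
      unfolding Fix_T_op_iff[where U = U, OF U E] mem_T_op_self_iff A_D_normal_cone[where U = U, OF U0]
      using L1[of x] by auto
    also have "\<dots> \<longleftrightarrow> (\<exists>y. x = vec_tensor 1 y \<and> vec_tensor 1 y \<in> product_set U \<and>
        mat_tensor Z v - mat_tensor (P_mat E) (vec_tensor 1 y) \<in> (product_set U)\<^sup>\<bottom>)"
      unfolding ker diagonal_iff normal_cone_def by (auto split: if_splits)
    finally show ?thesis
      unfolding U1 P1 .
  qed
  then show ?thesis
    by auto
qed

lemma adjoint_C_op:
  "adjoint (C_op Z) = (\<lambda>(x, v). mat_tensor (transpose Z) x + (v :: 'a::real_inner ^ 'm))"
  by (rule adjoint_unique)
     (auto simp: C_op_def inner_mat_tensor mat_tensor_mat_1 inner_add_right)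

text \<open>
  If \<open>(x, w) \<in> (\<M> + \<A>)\<inverse> \<C> v\<close> and \<open>\<C>\<^sup>* (x, w) = v\<close>, then \<open>v = 2 Z\<^sup>* x + w\<close> and \<open>v = Z\<^sup>* x + w\<close>, so
  \<open>Z\<^sup>* x = 0\<close> and \<open>w = v\<close>. For such \<open>x\<close> the inputs \<open>\<C> v\<close> and \<open>\<M> (x, v)\<close> coincide.
\<close>

lemma Fix_T_reduced_eq:
  fixes U :: "'n::{finite,linorder} \<Rightarrow> 'a::real_inner set"
  assumes U: "\<And>i. subspace (U i)" and E: "algorithmic_graph E"
    and L: "Lap E' = Z ** transpose Z"
  shows "Fix (T_reduced (\<lambda>i. normal_cone (U i)) E E' Z) =
    snd ` Fix (T_op (\<lambda>i. normal_cone (U i)) E E' Z)"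
proof -
  let ?A = "\<lambda>i. normal_cone (U i)"
  let ?R = "op_inverse (M_plus_A ?A E E' Z)"
  let ?t = "mat_tensor (transpose Z)"
  have red: "v \<in> Fix (T_reduced ?A E E' Z) \<longleftrightarrow> (\<exists>x w. (x, w) \<in> ?R (C_op Z v) \<and> ?t x + w = v)" for v
  proof
    assume "v \<in> Fix (T_reduced ?A E E' Z)"
    then have "v \<in> T_reduced ?A E E' Z v"
      by (simp add: Fix_def)
    then obtain x w where "(x, w) \<in> ?R (C_op Z v)" "v = adjoint (C_op Z) (x, w)"
      unfolding T_reduced_def by auto
    then show "\<exists>x w. (x, w) \<in> ?R (C_op Z v) \<and> ?t x + w = v"
      unfolding adjoint_C_op prod.case by metis
  next
    assume "\<exists>x w. (x, w) \<in> ?R (C_op Z v) \<and> ?t x + w = v"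
    then obtain x w where xw: "(x, w) \<in> ?R (C_op Z v)" "?t x + w = v"
      by blast
    then have "?R (C_op Z v) = {(x, w)}"
      using resolvent_unique[where U = U, OF U E] by blast
    then show "v \<in> Fix (T_reduced ?A E E' Z)"
      using xw by (simp add: Fix_def T_reduced_def adjoint_C_op)
  qed
  have "(x, w) \<in> ?R (C_op Z v) \<and> ?t x + w = v \<longleftrightarrow> w = v \<and> (x, v) \<in> Fix (T_op ?A E E' Z)" for x w v
  proof -
    have t0: "v = 2 *\<^sub>R ?t x + w \<and> ?t x + w = v \<longleftrightarrow> w = v \<and> ?t x = 0"
      by (simp only: scaleR_2) (metis add_0 add_right_cancel)
    have "mat_tensor (Lap E') x = 0" if "?t x = 0"
      using that by (simp add: L mat_tensor_mult mat_tensor_0)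
    then have "?t x = 0 \<Longrightarrow> mat_tensor (Lap E') x + mat_tensor Z v - mat_tensor (P_mat E) x =
        mat_tensor Z v - mat_tensor (P_mat E) x"
      by simp
    with t0 show ?thesis
      unfolding Fix_T_op_iff[where U = U, OF U E] mem_T_op_self_iff C_op_def mem_resolvent_iff
        mat_tensor_mat_1
      by metis
  qed
  then have "v \<in> Fix (T_reduced ?A E E' Z) \<longleftrightarrow> (\<exists>x. (x, v) \<in> Fix (T_op ?A E E' Z))" for v
    unfolding red by blast
  then show ?thesis
    by (simp add: set_eq_iff image_iff Bex_def)
qed

theorem proposition4p3:
  fixes U :: "'n::{finite,linorder} \<Rightarrow> 'a::{real_inner,complete_space} set"
    and A :: "'n \<Rightarrow> 'a \<Rightarrow> 'a set"
    and E E' :: "('n \<times> 'n) set"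
    and Z :: "real ^ 'm ^ 'n::{finite,linorder}"
  assumes "CARD('n) = CARD('m) + 1"
    and "\<And>i. subspace (U i)"
    and "\<And>i. closed (U i)"
    and "\<And>i. A i = normal_cone (U i)"
    and "algorithmic_graph E"
    and "E' \<subseteq> E"
    and "graph_connected E'"
    and "Lap E' = Z ** transpose Z"
  shows "is_orthogonal_sum (Fix (T_op A E E' Z))
           (pair_tensor (1, alpha E Z) ` (\<Inter>i. U i)) ({0} \<times> E_set Z U) \<and>
         is_orthogonal_sum (Fix (T_reduced A E E' Z))
           (vec_tensor (alpha E Z) ` (\<Inter>i. U i)) (E_set Z U)"
proof -
  have A: "A = (\<lambda>i. normal_cone (U i))"
    using assms(4) by blast
  have asym: "\<And>i j. (i, j) \<in> E' \<Longrightarrow> (j, i) \<notin> E'"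
    using algorithmic_graph_asym[OF assms(5)] assms(6) by blast
  let ?X = "moore_penrose Z" and ?\<delta> = "degree_balance E"
  have ker: "mat_tensor (transpose Z) x = 0 \<longleftrightarrow> x \<in> diagonal" for x :: "'a ^ 'n::{finite,linorder}"
    by (simp add: mat_tensor_transpose_eq_0_iff assms(8)[symmetric] Lap_kernel[OF asym assms(7)])
  have "mat_tensor (transpose Z) x = 0 \<longleftrightarrow> x \<in> diagonal" for x :: "real ^ 'n::{finite,linorder}"
    by (simp add: mat_tensor_transpose_eq_0_iff assms(8)[symmetric] Lap_kernel[OF asym assms(7)])
  then have inj: "inj ((*v) Z)"
    using injective_if_transpose_kernel_diagonal[OF assms(1)] by blast
  note mp = moore_penrose_injective[OF inj]
  have XZ: "mat_tensor ?X (mat_tensor Z w) = w" for w :: "'a ^ 'm"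
    by (simp add: mat_tensor_mult[symmetric] mp(2) mat_tensor_mat_1)
  have ZX: "mat_tensor Z (mat_tensor ?X u) = u" if "u \<in> diagonal\<^sup>\<bottom>" for u :: "'a ^ 'n::{finite,linorder}"
    using factor_moore_penrose_on_diagonal_comp[OF mp(1) ker that] .
  have range: "mat_tensor Z w \<in> diagonal\<^sup>\<bottom>" for w :: "'a ^ 'm"
  proof -
    have "inner y (mat_tensor Z w) = 0" if "y \<in> diagonal" for y
      using that ker[of y] by (simp add: inner_commute[of y] inner_mat_tensor)
    then show ?thesis
      by (simp add: orthogonal_comp_def orthogonal_def)
  qed
  \<comment> \<open>Here \<open>Z\<close> and \<open>Z\<^sup>\<dagger>\<close> restrict to mutually inverse bijections between \<open>\<H>\<^sup>n\<^sup>-\<^sup>1\<close> and \<open>\<Delta>\<^sup>\<bottom>\<close>.\<close>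
  have E_set: "w \<in> E_set Z U \<longleftrightarrow> mat_tensor Z w \<in> (product_set U)\<^sup>\<bottom>" for w
  proof
    assume "mat_tensor Z w \<in> (product_set U)\<^sup>\<bottom>"
    then show "w \<in> E_set Z U"
      unfolding E_set_def using range[of w] XZ[of w] by (metis IntI image_eqI)
  qed (auto simp: E_set_def ZX)
  have "vec_tensor ?\<delta> y \<in> diagonal\<^sup>\<bottom>" for y :: 'a
    by (simp add: diagonal_comp_iff vec_tensor_def scaleR_sum_left[symmetric] sum_degree_balance)
  then have Z\<alpha>: "mat_tensor Z (vec_tensor (alpha E Z) y) = vec_tensor ?\<delta> y" for y :: 'a
    using ZX by (metis alpha_def mat_tensor_vec_tensor)
  have fixT: "Fix (T_op A E E' Z) =
      {(vec_tensor 1 y, v) | y v. y \<in> (\<Inter>i. U i) \<and> v - vec_tensor (alpha E Z) y \<in> E_set Z U}"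
    unfolding A Fix_T_op_eq[where U = U, OF assms(2,5,8) ker] by (simp add: E_set mat_tensor_diff Z\<alpha>)
  have sumT: "Fix (T_op A E E' Z) =
      pair_tensor (1, alpha E Z) ` (\<Inter>i. U i) + {0} \<times> E_set Z U" (is "_ = ?S")
  proof (intro equalityI subsetI)
    fix z assume "z \<in> Fix (T_op A E E' Z)"
    then obtain y v where z: "z = (vec_tensor 1 y, v)" and y: "y \<in> (\<Inter>i. U i)"
      and v: "v - vec_tensor (alpha E Z) y \<in> E_set Z U"
      unfolding fixT by blast
    have "z = pair_tensor (1, alpha E Z) y + (0, v - vec_tensor (alpha E Z) y)"
      by (simp add: z pair_tensor_def)
    then show "z \<in> ?S"
      using y v by (auto intro!: set_plus_intro)
  next
    fix z assume "z \<in> ?S"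
    then obtain y w where y: "y \<in> (\<Inter>i. U i)" and w: "w \<in> E_set Z U"
      and "z = pair_tensor (1, alpha E Z) y + (0, w)"
      by (auto elim!: set_plus_elim)
    then have "z = (vec_tensor 1 y, vec_tensor (alpha E Z) y + w)"
      by (simp add: pair_tensor_def)
    then show "z \<in> Fix (T_op A E E' Z)"
      unfolding fixT mem_Collect_eq using y w
      by (intro exI[of _ y] exI[of _ "vec_tensor (alpha E Z) y + w"]) simp
  qed
  have sumR: "Fix (T_reduced A E E' Z) = vec_tensor (alpha E Z) ` (\<Inter>i. U i) + E_set Z U"
    unfolding A Fix_T_reduced_eq[where U = U, OF assms(2,5,8)]
    unfolding A[symmetric] sumT
    by (force simp: set_plus_def pair_tensor_def image_iff)
  have orth: "orthogonal (vec_tensor (alpha E Z) y) w" if "y \<in> (\<Inter>i. U i)" "w \<in> E_set Z U" for y w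
  proof -
    obtain u where u: "w = mat_tensor ?X u" "u \<in> (product_set U)\<^sup>\<bottom>"
      using \<open>w \<in> E_set Z U\<close> by (auto simp: E_set_def)
    \<comment> \<open>\<open>\<langle>\<alpha> y, Z\<^sup>\<dagger> u\<rangle> = \<langle>(Z\<^sup>\<dagger>)\<^sup>* \<alpha> y, u\<rangle>\<close>, and every component of the left vector is a multiple of \<open>y\<close>.\<close>
    have "vec_tensor (transpose ?X *v alpha E Z) y \<in> product_set U"
      using that assms(2) by (simp add: product_set_def vec_tensor_def subspace_scale)
    then have "inner (vec_tensor (transpose ?X *v alpha E Z) y) u = 0"
      using u by (simp add: orthogonal_comp_def orthogonal_def)
    then show ?thesis
      by (simp add: u orthogonal_def inner_commute[of _ "mat_tensor ?X u"] inner_mat_tensor mat_tensor_vec_tensor inner_commute[of u])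
  qed
  then have "orthogonal (pair_tensor (1, alpha E Z) y) (0, w)" if "y \<in> (\<Inter>i. U i)" "w \<in> E_set Z U" for y w
    using that by (simp add: orthogonal_def pair_tensor_def)
  then show ?thesis
    using sumT sumR orth by (auto simp: is_orthogonal_sum_def)
qed

end
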